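(* Let $f$ be an asymptotically quasi-homogeneous vector field of type $\alpha=(\alpha_1,\ldots,\alpha_n)$ and order $k+1$ at infinity, with quasi-homogeneous part $f_{\alpha,k}$. Suppose that a nontrivial (i.e. nonzero) root $Y_0$ of the balance law $$-\tfrac1k\Lambda_\alpha Y_0+f_{\alpha,k}(Y_0)=0$$ is given. Then the corresponding blow-up power-determining matrix $$A=-\tfrac1k\Lambda_\alpha+Df_{\alpha,k}(Y_0)$$ has the eigenvalue $1$ with the associated eigenvector $v_{0,\alpha}=\Lambda_\alpha Y_0$.
   Context: $\alpha_1,\ldots,\alpha_n$ are nonnegative integers, not all zero, $k>0$ is real, $\Lambda_\alpha=\mathrm{diag}(\alpha_1,\ldots,\alpha_n)$, $s^{\Lambda_\alpha}=\mathrm{diag}(s^{\alpha_1},\ldots,s^{\alpha_n})$ for $s>0$. The map $f:\mathbb{R}^n\to\mathbb{R}^n$ is $C^r$, $r\ge2$, and is asymptotically quasi-homogeneous of type $\alpha$ and order $k+1$ at infinity: there is a vector field $f_{\alpha,k}$ which is quasi-homogeneous of type $\alpha$ and order $k+1$, i.e. $f_{i;\alpha,k}(s^{\Lambda_\alpha}x)=s^{k+\alpha_i}f_{i;\alpha,k}(x)$ for all $x\in\mathbb{R}^n$, $s>0$, $i=1,\ldots,n$, such that $f_i(s^{\Lambda_\alpha}x)-s^{k+\alpha_i}f_{i;\alpha,k}(x)=o(s^{k+\alpha_i})$ as $s\to+\infty$ uniformly for $x$ in the unit sphere. $f_{\alpha,k}$ is $C^1$.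
   Formalization: The eigenvalue and eigenvector claims are stated only when Λ_α Y_0 ≠ 0; it can vanish for nonzero Y_0 if some α_i = 0, e.g. α=(0,1), k=1, f=(x_2,x_2^2), Y_0=(1,0), where A has eigenvalues 0 and -1. The identity AΛ_αY_0=Λ_αY_0 is kept in all cases. *)

theory Defs
  imports "HOL-Analysis.Analysis"
begin

text \<open>\<open>C\<close>-class on the whole space: all iterated directional derivatives up to order \<open>r\<close> exist
  (as values of Frechet derivatives) and are continuous.\<close>

fun C_class :: "nat \<Rightarrow> ('a::euclidean_space \<Rightarrow> 'b::euclidean_space) \<Rightarrow> bool" where
  "C_class 0 f \<longleftrightarrow> continuous_on UNIV f"
| "C_class (Suc r) f \<longleftrightarrow>
     (\<forall>x. f differentiable at x) \<and> (\<forall>v. C_class r (\<lambda>x. frechet_derivative f (at x) v))"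

definition diag_matrix :: "('n \<Rightarrow> real) \<Rightarrow> real^'n^'n" where
  "diag_matrix d = (\<chi> i j. if i = j then d i else 0)"

definition Lambda :: "('n \<Rightarrow> nat) \<Rightarrow> real^'n^'n" where
  "Lambda \<alpha> = diag_matrix (\<lambda>i. real (\<alpha> i))"

text \<open>The matrix \<open>s\<close> to the power \<open>Lambda \<alpha>\<close>.\<close>

definition powLambda :: "real \<Rightarrow> ('n \<Rightarrow> nat) \<Rightarrow> real^'n^'n" where
  "powLambda s \<alpha> = diag_matrix (\<lambda>i. s ^ \<alpha> i)"

text \<open>In both notions below the argument is \<open>k\<close>, while the order of the vector field is \<open>k + 1\<close>.\<close>

definition quasi_homogeneous ::
    "('n::finite \<Rightarrow> nat) \<Rightarrow> real \<Rightarrow> (real^'n \<Rightarrow> real^'n) \<Rightarrow> bool" where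
  "quasi_homogeneous \<alpha> k g \<longleftrightarrow>
     (\<forall>x. \<forall>s>0. \<forall>i. g (powLambda s \<alpha> *v x) $ i = s powr (k + real (\<alpha> i)) * g x $ i)"

definition asymptotically_quasi_homogeneous ::
    "('n::finite \<Rightarrow> nat) \<Rightarrow> real \<Rightarrow> (real^'n \<Rightarrow> real^'n) \<Rightarrow> (real^'n \<Rightarrow> real^'n) \<Rightarrow> bool" where
  "asymptotically_quasi_homogeneous \<alpha> k f g \<longleftrightarrow>
     quasi_homogeneous \<alpha> k g \<and>
     (\<forall>i. uniform_limit (sphere 0 1)
        (\<lambda>s x. (f (powLambda s \<alpha> *v x) $ i - s powr (k + real (\<alpha> i)) * g x $ i)
                 / s powr (k + real (\<alpha> i)))
        (\<lambda>x. 0) at_top)"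

definition balance_law_root ::
    "('n::finite \<Rightarrow> nat) \<Rightarrow> real \<Rightarrow> (real^'n \<Rightarrow> real^'n) \<Rightarrow> real^'n \<Rightarrow> bool" where
  "balance_law_root \<alpha> k g Y \<longleftrightarrow> - (1 / k) *\<^sub>R (Lambda \<alpha> *v Y) + g Y = 0"

definition blowup_power_matrix ::
    "('n::finite \<Rightarrow> nat) \<Rightarrow> real \<Rightarrow> (real^'n \<Rightarrow> real^'n) \<Rightarrow> real^'n \<Rightarrow> real^'n^'n" where
  "blowup_power_matrix \<alpha> k g Y = - (1 / k) *\<^sub>R Lambda \<alpha> + jacobian g (at Y)"

definition is_eigenvector :: "real^'n^'n \<Rightarrow> real^'n \<Rightarrow> real \<Rightarrow> bool" where
  "is_eigenvector M v c \<longleftrightarrow> v \<noteq> 0 \<and> M *v v = c *s v"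

definition is_eigenvalue :: "real^'n^'n \<Rightarrow> real \<Rightarrow> bool" where
  "is_eigenvalue M c \<longleftrightarrow> (\<exists>v. is_eigenvector M v c)"

end

theory Submission
  imports Defs
begin

text \<open>Differentiating the scaling relation of \<open>f\<alpha>k\<close> along the curve \<open>s \<mapsto> s\<^sup>\<Lambda> x\<close> at \<open>s = 1\<close> gives
  Euler's identity \<open>Df\<alpha>k(x) \<Lambda> x = (k I + \<Lambda>) f\<alpha>k(x)\<close>. At a root of the balance law
  \<open>f\<alpha>k(Y0) = \<Lambda> Y0 / k\<close>, so the right-hand side is \<open>\<Lambda> Y0 + \<Lambda>\<^sup>2 Y0 / k\<close>, and the term
  \<open>- \<Lambda> / k\<close> of the matrix cancels the second summand.\<close>

lemma diag_matrix_mult_vec_nth [simp]: "(diag_matrix d *v x) $ i = d i * x $ i"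
  by (simp add: diag_matrix_def matrix_vector_mult_def if_distrib[where f = "\<lambda>a. a * _"] cong: if_cong)

lemma Lambda_mult_vec_nth [simp]: "(Lambda \<alpha> *v x) $ i = real (\<alpha> i) * x $ i"
  by (simp add: Lambda_def)

lemma powLambda_mult_vec_nth [simp]: "(powLambda s \<alpha> *v x) $ i = s ^ \<alpha> i * x $ i"
  by (simp add: powLambda_def)

lemma powLambda_1_mult_vec [simp]: "powLambda 1 \<alpha> *v x = x"
  by (simp add: vec_eq_iff)

text \<open>Each coordinate \<open>s ^ \<alpha> i * x $ i\<close> has slope
  \<open>\<alpha> i * x $ i\<close> at 1, so \<open>Lambda \<alpha>\<close> generates the scaling
  action.\<close>

lemma has_vector_derivative_powLambda_at_1:
  "((\<lambda>s. powLambda s \<alpha> *v x) has_vector_derivative Lambda \<alpha> *v x) (at 1)"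
proof -
  have "((\<lambda>s. s ^ \<alpha> i * x $ i) has_derivative (\<lambda>h. h * (real (\<alpha> i) * x $ i))) (at 1)" for i
    by (auto intro!: derivative_eq_intros)
  then show ?thesis
    unfolding has_vector_derivative_def
    by (subst has_derivative_componentwise_within)
      (auto simp: Basis_vec_def inner_axis)
qed

lemma quasi_homogeneous_Euler_identity:
  assumes hom: "quasi_homogeneous \<alpha> k g" and diff: "g differentiable at x"
  shows "jacobian g (at x) *v (Lambda \<alpha> *v x) = k *\<^sub>R g x + Lambda \<alpha> *v g x"
proof -
  let ?w = "jacobian g (at x) *v (Lambda \<alpha> *v x)"
  \<comment> \<open>The base point is written as the value of the curve at 1, the form the chain
    rule expects.\<close>
  have "(g has_derivative (\<lambda>h. jacobian g (at x) *v h)) (at (powLambda 1 \<alpha> *v x))"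
    using diff by (simp add: jacobian_works)
  from has_derivative_compose[OF has_vector_derivative_powLambda_at_1[unfolded has_vector_derivative_def] this]
  have chain: "((\<lambda>s. g (powLambda s \<alpha> *v x)) has_vector_derivative ?w) (at 1)"
    by (simp add: has_vector_derivative_def matrix_vector_mult_scaleR)
  \<comment> \<open>The scaling exponent depends on the coordinate, so two derivatives of one real
    function are compared for each \<open>i\<close>.\<close>
  have "?w $ i = (k + real (\<alpha> i)) * g x $ i" for i
  proof -
    have "((\<lambda>s. g (powLambda s \<alpha> *v x) $ i) has_real_derivative ?w $ i) (at 1)"
      using bounded_linear.has_vector_derivative[OF bounded_linear_vec_nth chain]
      by (simp add: has_real_derivative_iff_has_vector_derivative)
    moreover have "((\<lambda>s. g (powLambda s \<alpha> *v x) $ i) has_real_derivative (k + real (\<alpha> i)) * g x $ i) (at 1)"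
    proof (rule DERIV_cong_ev[OF refl _ refl, THEN iffD2])
      \<comment> \<open>The scaling law is available only for \<open>s > 0\<close>, which is a
        neighbourhood of 1.\<close>
      show "\<forall>\<^sub>F s in nhds 1. g (powLambda s \<alpha> *v x) $ i = s powr (k + real (\<alpha> i)) * g x $ i"
        using eventually_nhds_in_open[of "{0::real<..}" 1] hom
        by (auto simp: quasi_homogeneous_def elim!: eventually_mono)
      show "((\<lambda>s. s powr (k + real (\<alpha> i)) * g x $ i) has_real_derivative (k + real (\<alpha> i)) * g x $ i) (at 1)"
        by (auto intro!: derivative_eq_intros)
    qed
    ultimately show ?thesis
      by (rule DERIV_unique)
  qed
  then show ?thesis
    by (simp add: vec_eq_iff distrib_right)
qed

text \<open>If some \<open>\<alpha> i\<close> vanish, any nonzero \<open>Y0\<close> supported on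
  those coordinates is a root with \<open>Lambda \<alpha> *v Y0 = 0\<close>. The eigenvector claim
  is therefore guarded, while the matrix identity holds in every case.\<close>

theorem theorem3p6:
  fixes \<alpha> :: "'n::finite \<Rightarrow> nat"
    and k :: real
    and r :: nat
    and f f\<alpha>k :: "real^'n \<Rightarrow> real^'n"
    and Y0 :: "real^'n"
  assumes "\<exists>i. \<alpha> i \<noteq> 0"
    and "k > 0"
    and "r \<ge> 2" and "C_class r f"
    and "asymptotically_quasi_homogeneous \<alpha> k f f\<alpha>k"
    and "C_class 1 f\<alpha>k"
    and "Y0 \<noteq> 0"
    and "balance_law_root \<alpha> k f\<alpha>k Y0"
  shows "blowup_power_matrix \<alpha> k f\<alpha>k Y0 *v (Lambda \<alpha> *v Y0) = 1 *s (Lambda \<alpha> *v Y0)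
    \<and> (Lambda \<alpha> *v Y0 \<noteq> 0 \<longrightarrow>
        is_eigenvalue (blowup_power_matrix \<alpha> k f\<alpha>k Y0) 1
        \<and> is_eigenvector (blowup_power_matrix \<alpha> k f\<alpha>k Y0) (Lambda \<alpha> *v Y0) 1)"
proof -
  have "f\<alpha>k differentiable at Y0"
    \<comment> \<open>Reading \<open>1\<close> as \<open>Suc 0\<close> exposes the recursive
      equation of \<open>C_class\<close>.\<close>
    using \<open>C_class 1 f\<alpha>k\<close> by (simp add: One_nat_def)
  with assms(5) have "jacobian f\<alpha>k (at Y0) *v (Lambda \<alpha> *v Y0) = k *\<^sub>R f\<alpha>k Y0 + Lambda \<alpha> *v f\<alpha>k Y0"
    by (intro quasi_homogeneous_Euler_identity) (simp_all add: asymptotically_quasi_homogeneous_def)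
  moreover have "f\<alpha>k Y0 = (1 / k) *\<^sub>R (Lambda \<alpha> *v Y0)"
    using \<open>balance_law_root \<alpha> k f\<alpha>k Y0\<close> by (simp add: balance_law_root_def)
  ultimately have "blowup_power_matrix \<alpha> k f\<alpha>k Y0 *v (Lambda \<alpha> *v Y0) = 1 *s (Lambda \<alpha> *v Y0)"
    using \<open>k > 0\<close>
    by (simp add: blowup_power_matrix_def matrix_vector_mult_add_rdistrib matrix_vector_mult_scaleR
        scaleR_matrix_vector_assoc[symmetric] matrix_vector_mult_diff_rdistrib)
  then show ?thesis
    by (auto simp: is_eigenvalue_def is_eigenvector_def)
qed

end
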